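(* In the single-buyer-type setting described in the context, there exists an optimal advertising rule $\langle S,\pi\rangle$ with $|S|\le n$ such that for all $s\in S$ the buyer's posterior $\eta^s$ has no more than $2|A|$ non-zero entries, i.e. $\Vert\eta^s\Vert_0\le 2|A|$.
   Context: Setting (single buyer type). $\Omega=\{1,\dots,n\}$ is the set of states, $\Delta\Omega$ the set of probability distributions on $\Omega$, $\mu\in\Delta\Omega$ the distribution of the state, $\theta\in\Delta\Omega$ the buyer's prior belief with $\theta_\omega>0$ for all $\omega$, $A$ a finite action set, $u:\Omega\times A\to[0,1]$ the utility. Cost of uncertainty: $C(\eta)=\sum_\omega \eta_\omega\max_{a\in A}u(\omega,a)-\max_{a\in A}\sum_\omega\eta_\omega u(\omega,a)$ for $\eta\in\Delta\Omega$. An advertising rule consists of a finite signal set $S$, a signaling scheme $\pi:\Omega\to\Delta S$ and prices $p_s$, $s\in S$. The buyer's posterior after $s$ is $\eta^s_\omega=\theta_\omega\pi(\omega,s)/\sum_{\omega'}\theta_{\omega'}\pi(\omega',s)$. The buyer purchases full revelation of $\omega$ iff $C(\eta^s)\ge p_s$; the seller's expected revenue is $\sum_\omega\mu_\omega\sum_s\pi(\omega,s)p_s\mathbf 1(C(\eta^s)\ge p_s)$, and a rule is optimal if it maximizes this over all rules. The notation $\langle S,\pi\rangle$ means the rule with prices $p_s=C(\eta^s)$. $\Vert\cdot\Vert_0$ counts non-zero entries. *)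

theory Defs
  imports Complex_Main "HOL-Library.Cardinality"
begin

text \<open>The state space \<open>\<Omega>\<close> is a finite type \<open>'w\<close>, so \<open>n = CARD('w)\<close>. Vectors indexed by states
  or by signals are real-valued functions.\<close>

definition distribution_on :: "'x set \<Rightarrow> ('x \<Rightarrow> real) \<Rightarrow> bool" where
  "distribution_on X p \<longleftrightarrow> (\<forall>x\<in>X. 0 \<le> p x) \<and> (\<Sum>x\<in>X. p x) = 1"

definition cost :: "'a set \<Rightarrow> ('w::finite \<Rightarrow> 'a \<Rightarrow> real) \<Rightarrow> ('w \<Rightarrow> real) \<Rightarrow> real" where
  "cost A u \<eta> = (\<Sum>\<omega>\<in>UNIV. \<eta> \<omega> * (MAX a\<in>A. u \<omega> a)) - (MAX a\<in>A. \<Sum>\<omega>\<in>UNIV. \<eta> \<omega> * u \<omega> a)"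

text \<open>The pair of \<open>S\<close> and \<open>\<pi>\<close> is the signaling part of an advertising rule; the prices are
  unrestricted reals and hence carry no condition.\<close>

definition signaling_scheme :: "'s set \<Rightarrow> ('w \<Rightarrow> 's \<Rightarrow> real) \<Rightarrow> bool" where
  "signaling_scheme S \<pi> \<longleftrightarrow> finite S \<and> (\<forall>\<omega>. distribution_on S (\<pi> \<omega>))"

definition signal_prob :: "('w::finite \<Rightarrow> real) \<Rightarrow> ('w \<Rightarrow> 's \<Rightarrow> real) \<Rightarrow> 's \<Rightarrow> real" where
  "signal_prob \<theta> \<pi> s = (\<Sum>\<omega>\<in>UNIV. \<theta> \<omega> * \<pi> \<omega> s)"

text \<open>If \<open>s\<close> has probability zero then the posterior below is the zero vector, by \<open>x / 0 = 0\<close>, and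
  not a distribution. Revenue is unaffected for a prior of full support, since then \<open>\<pi> \<omega> s = 0\<close>
  for every \<open>\<omega>\<close>.\<close>

definition posterior ::
    "('w::finite \<Rightarrow> real) \<Rightarrow> ('w \<Rightarrow> 's \<Rightarrow> real) \<Rightarrow> 's \<Rightarrow> 'w \<Rightarrow> real" where
  "posterior \<theta> \<pi> s \<omega> = \<theta> \<omega> * \<pi> \<omega> s / signal_prob \<theta> \<pi> s"

definition revenue ::
    "'a set \<Rightarrow> ('w::finite \<Rightarrow> 'a \<Rightarrow> real) \<Rightarrow> ('w \<Rightarrow> real) \<Rightarrow> ('w \<Rightarrow> real) \<Rightarrow>
      's set \<Rightarrow> ('w \<Rightarrow> 's \<Rightarrow> real) \<Rightarrow> ('s \<Rightarrow> real) \<Rightarrow> real" where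
  "revenue A u \<mu> \<theta> S \<pi> p =
    (\<Sum>\<omega>\<in>UNIV. \<mu> \<omega> * (\<Sum>s\<in>S. \<pi> \<omega> s * p s * of_bool (cost A u (posterior \<theta> \<pi> s) \<ge> p s)))"

text \<open>Rules may use any finite signal set. Competitors are labelled by natural numbers because HOL
  cannot quantify over the type of signals; the lemma \<open>optimal_rule_ge\<close> below
  shows that this loses no competitor.\<close>

definition optimal_rule ::
    "'a set \<Rightarrow> ('w::finite \<Rightarrow> 'a \<Rightarrow> real) \<Rightarrow> ('w \<Rightarrow> real) \<Rightarrow> ('w \<Rightarrow> real) \<Rightarrow>
      's set \<Rightarrow> ('w \<Rightarrow> 's \<Rightarrow> real) \<Rightarrow> ('s \<Rightarrow> real) \<Rightarrow> bool" where
  "optimal_rule A u \<mu> \<theta> S \<pi> p \<longleftrightarrow> signaling_scheme S \<pi> \<and>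
    (\<forall>(S' :: nat set) \<pi>' p'. signaling_scheme S' \<pi>' \<longrightarrow>
      revenue A u \<mu> \<theta> S' \<pi>' p' \<le> revenue A u \<mu> \<theta> S \<pi> p)"

definition full_price ::
    "'a set \<Rightarrow> ('w::finite \<Rightarrow> 'a \<Rightarrow> real) \<Rightarrow> ('w \<Rightarrow> real) \<Rightarrow> ('w \<Rightarrow> 's \<Rightarrow> real) \<Rightarrow> 's \<Rightarrow> real" where
  "full_price A u \<theta> \<pi> s = cost A u (posterior \<theta> \<pi> s)"

definition norm0 :: "('w::finite \<Rightarrow> real) \<Rightarrow> nat" where
  "norm0 \<eta> = card {\<omega>. \<eta> \<omega> \<noteq> 0}"

lemma optimal_rule_ge:
  fixes S' :: "'t set" and S :: "'s set"
  assumes opt: "optimal_rule A u \<mu> \<theta> S \<pi> p" and sch: "signaling_scheme S' \<pi>'"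
  shows "revenue A u \<mu> \<theta> S' \<pi>' p' \<le> revenue A u \<mu> \<theta> S \<pi> p"
proof -
  obtain f :: "nat \<Rightarrow> 't" where f: "bij_betw f {0..<card S'} S'"
    using sch ex_bij_betw_nat_finite unfolding signaling_scheme_def by blast
  have re: "(\<Sum>i\<in>{0..<card S'}. g (f i)) = sum g S'" for g :: "'t \<Rightarrow> real"
    using f by (rule sum.reindex_bij_betw)
  have mem: "f i \<in> S'" if "i < card S'" for i
    using f that by (auto simp: bij_betw_def)
  have sch2: "signaling_scheme {0..<card S'} (\<lambda>\<omega> i. \<pi>' \<omega> (f i))"
    using sch mem by (auto simp: signaling_scheme_def distribution_on_def re)
  have post: "posterior \<theta> (\<lambda>\<omega> i. \<pi>' \<omega> (f i)) i = posterior \<theta> \<pi>' (f i)" for i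
    by (simp add: posterior_def signal_prob_def fun_eq_iff)
  have "revenue A u \<mu> \<theta> {0..<card S'} (\<lambda>\<omega> i. \<pi>' \<omega> (f i)) (\<lambda>i. p' (f i))
      = revenue A u \<mu> \<theta> S' \<pi>' p'"
    unfolding revenue_def post
    by (subst re[where g = "\<lambda>s. \<pi>' _ s * p' s * of_bool (p' s \<le> cost A u (posterior \<theta> \<pi>' s))"])
       (rule refl)
  then show ?thesis
    using opt sch2 unfolding optimal_rule_def by metis
qed

end

theory Submission
  imports Defs "HOL-Analysis.Analysis"
begin

text \<open>A signal \<open>s\<close> is encoded by the vector \<open>x\<^sub>s \<omega> = \<theta> \<omega> * \<pi> \<omega> s\<close>, so that a signaling scheme is a
  splitting of \<open>\<theta>\<close> into nonnegative vectors, and charging \<open>C(\<eta>\<^sup>s)\<close> earns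
  \<open>F(x) = (\<Sum>\<omega>. \<mu> \<omega> / \<theta> \<omega> * x \<omega>) * C(x) / (\<Sum>\<omega>. x \<omega>)\<close> from each part, a positively homogeneous function.
  A linear dependence among more than \<open>n\<close> parts allows a reweighting that does not decrease the total
  and kills a part, so \<open>n\<close> parts suffice and a maximum exists by compactness. If a part has support
  larger than \<open>|A| + 1\<close>, some direction \<open>d\<close> within the support preserves the total mass, the factor
  \<open>\<Sum>\<omega>. \<mu> \<omega> / \<theta> \<omega> * x \<omega>\<close> and all utility differences between actions. Since \<open>F\<close> is affine along \<open>d\<close>, the part
  splits, without loss, into two parts on the boundary of the orthant, which have smaller support.
  This gives the bound \<open>|A| + 1 \<le> 2 |A|\<close>, and a final reweighting restores at most \<open>n\<close> parts.\<close>

section \<open>Linear dependences and steps to the boundary of an orthant\<close>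

text \<open>Gaussian elimination, by induction on the equations: an equation that vanishes on
  \<open>W\<close> is dropped, and any other one is used to eliminate an unknown.\<close>

lemma homogeneous_system_nontrivial_solution:
  fixes m :: "'i \<Rightarrow> 'x \<Rightarrow> real"
  assumes "finite I" and "finite W" and "card I < card W"
  shows "\<exists>d. (\<exists>w\<in>W. d w \<noteq> 0) \<and> (\<forall>i\<in>I. (\<Sum>w\<in>W. m i w * d w) = 0)"
  using assms
proof (induction I arbitrary: W m rule: finite_induct)
  case empty
  then have "W \<noteq> {}" by auto
  then show ?case by (intro exI[of _ "\<lambda>_. 1"]) auto
next
  case (insert i I)
  show ?case
  proof (cases "\<forall>w\<in>W. m i w = 0")
    case True
    obtain d where "\<exists>w\<in>W. d w \<noteq> 0" "\<forall>j\<in>I. (\<Sum>w\<in>W. m j w * d w) = 0"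
      using insert.IH[of W m] insert.prems insert.hyps by auto
    then show ?thesis using True by (intro exI[of _ d]) auto
  next
    case False
    then obtain v where v: "v \<in> W" "m i v \<noteq> 0" by blast
    \<comment> \<open>Row \<open>j\<close> after subtracting the multiple of row \<open>i\<close>
      that makes the coefficient at the pivot \<open>v\<close> zero.\<close>
    define m' where "m' j w = m j w - m j v * m i w / m i v" for j w
    have "card I < card (W - {v})"
      using insert.prems insert.hyps v by simp
    then obtain d where d: "\<exists>w\<in>W - {v}. d w \<noteq> 0"
        "\<And>j. j \<in> I \<Longrightarrow> (\<Sum>w\<in>W - {v}. m' j w * d w) = 0"
      using insert.IH[of "W - {v}" m'] insert.prems by auto
    define q where "q = (\<Sum>w\<in>W - {v}. m i w * d w)"
    \<comment> \<open>Back substitution: the value at \<open>v\<close> is the one that equation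
      \<open>i\<close> forces.\<close>
    define e where "e = d(v := - q / m i v)"
    have sum_e: "(\<Sum>w\<in>W. m j w * e w) = - m j v * q / m i v + (\<Sum>w\<in>W - {v}. m j w * d w)" for j
      using insert.prems v by (subst sum.remove[of W v]) (auto simp: e_def intro!: sum.cong)
    have "(\<Sum>w\<in>W - {v}. m' j w * d w) = (\<Sum>w\<in>W - {v}. m j w * d w) - m j v * q / m i v" for j
      by (simp add: m'_def q_def algebra_simps sum_subtractf sum_distrib_left sum_divide_distrib)
    then have "(\<Sum>w\<in>W. m j w * e w) = 0" if "j \<in> I" for j
      using d(2)[OF that] by (simp add: sum_e)
    moreover have "(\<Sum>w\<in>W. m i w * e w) = 0"
      using v by (simp add: sum_e q_def[symmetric])
    moreover have "\<exists>w\<in>W. e w \<noteq> 0"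
      using d(1) by (auto simp: e_def)
    ultimately show ?thesis by auto
  qed
qed

text \<open>Ensures that a ray in direction \<open>d\<close> leaves the positive orthant, so that
  \<open>step_to_boundary\<close> applies.\<close>

lemma weighted_sum_zero_imp_negative:
  fixes p d :: "'x \<Rightarrow> real"
  assumes "finite W" and "\<And>w. w \<in> W \<Longrightarrow> p w > 0" and "(\<Sum>w\<in>W. p w * d w) = 0"
    and "\<exists>w\<in>W. d w \<noteq> 0"
  shows "\<exists>w\<in>W. d w < 0"
proof (rule ccontr)
  assume "\<not> ?thesis"
  then have "0 \<le> p w * d w" if "w \<in> W" for w
    using assms(2)[OF that] that by (simp add: not_less)
  then have "\<forall>w\<in>W. p w * d w = 0"
    using assms by (simp add: sum_nonneg_eq_0_iff)
  then show False using assms(2,4) by fastforce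
qed

text \<open>The ratio test of the simplex method: only coordinates with \<open>d w < 0\<close>
  decrease, and the smallest ratio \<open>x w / - d w\<close> tells which of them vanishes
  first.\<close>

lemma step_to_boundary:
  fixes x d :: "'x \<Rightarrow> real"
  assumes "finite W" and "\<And>w. w \<in> W \<Longrightarrow> x w > 0" and "\<exists>w\<in>W. d w < 0"
  shows "\<exists>t>0. (\<forall>w\<in>W. 0 \<le> x w + t * d w) \<and> (\<exists>w\<in>W. x w + t * d w = 0)"
proof -
  define N where "N = {w\<in>W. d w < 0}"
  define t where "t = Min ((\<lambda>w. x w / - d w) ` N)"
  have N: "finite N" "N \<noteq> {}" using assms by (auto simp: N_def)
  have "t \<in> (\<lambda>w. x w / - d w) ` N"
    unfolding t_def using N by (intro Min_in) auto
  then obtain v where v: "v \<in> N" "t = x v / - d v" by blast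
  have "t > 0" using v assms(2) by (auto simp: N_def divide_pos_neg)
  have "0 \<le> x w + t * d w" if "w \<in> W" for w
  proof (cases "d w < 0")
    case True
    then have "t \<le> x w / - d w"
      unfolding t_def using N that by (intro Min_le) (auto simp: N_def)
    then show ?thesis using True by (simp add: field_simps)
  next
    case False
    then show ?thesis using assms(2)[OF that] \<open>t > 0\<close> by simp
  qed
  moreover have "x v + t * d v = 0" using v by (simp add: N_def)
  ultimately show ?thesis using \<open>t > 0\<close> v(1) by (auto simp: N_def)
qed

text \<open>Caratheodory's theorem for cones, with a linear objective in the weights carried along.
  The vectors \<open>x s\<close> are only reweighted, never altered, so \<open>f\<close> may be
  arbitrary and properties of the single vectors, such as sparsity, survive.\<close>

lemma conic_caratheodory_objective:
  fixes x :: "'s \<Rightarrow> 'w::finite \<Rightarrow> real" and f c :: "'s \<Rightarrow> real"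
  assumes "finite S" and "\<And>s \<omega>. s \<in> S \<Longrightarrow> 0 \<le> x s \<omega>" and "\<And>s. s \<in> S \<Longrightarrow> (\<Sum>\<omega>\<in>UNIV. x s \<omega>) > 0"
    and "\<And>s. s \<in> S \<Longrightarrow> 0 \<le> c s"
  shows "\<exists>T c'. T \<subseteq> S \<and> card T \<le> CARD('w) \<and> (\<forall>s\<in>T. c' s > 0) \<and>
      (\<forall>\<omega>. (\<Sum>s\<in>T. c' s * x s \<omega>) = (\<Sum>s\<in>S. c s * x s \<omega>)) \<and>
      (\<Sum>s\<in>S. c s * f s) \<le> (\<Sum>s\<in>T. c' s * f s)"
  using assms
proof (induction "card S" arbitrary: S c rule: less_induct)
  case less
  \<comment> \<open>The induction step, shared by two situations: a weight that is zero from the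
    start, and a weight brought to zero by moving along a dependence.\<close>
  have drop_zero: ?case if zero: "v \<in> S" "c' v = 0" and nonneg: "\<And>s. s \<in> S \<Longrightarrow> 0 \<le> c' s"
    and same: "\<And>\<omega>. (\<Sum>s\<in>S. c' s * x s \<omega>) = (\<Sum>s\<in>S. c s * x s \<omega>)"
    and ge: "(\<Sum>s\<in>S. c s * f s) \<le> (\<Sum>s\<in>S. c' s * f s)" for c' v
  proof -
    have eq: "(\<Sum>s\<in>S. c' s * g s) = (\<Sum>s\<in>S - {v}. c' s * g s)" for g
      using zero less.prems(1) by (simp add: sum.remove[of S v])
    have "card (S - {v}) < card S"
      using zero less.prems(1) by (meson card_Diff1_less)
    from less.hyps[OF this, of c'] obtain T c'' where T: "T \<subseteq> S - {v}" "card T \<le> CARD('w)"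
        "\<forall>s\<in>T. c'' s > 0"
        "\<forall>\<omega>. (\<Sum>s\<in>T. c'' s * x s \<omega>) = (\<Sum>s\<in>S - {v}. c' s * x s \<omega>)"
        "(\<Sum>s\<in>S - {v}. c' s * f s) \<le> (\<Sum>s\<in>T. c'' s * f s)"
      using less.prems nonneg by auto
    then show ?thesis
      using same ge unfolding eq by (intro exI[of _ T] exI[of _ c'']) auto
  qed
  show ?case
  proof (cases "\<exists>s\<in>S. c s = 0")
    case True
    then show ?thesis using drop_zero[of _ c] less.prems by auto
  next
    case False
    then have pos: "c s > 0" if "s \<in> S" for s
      using less.prems(4)[OF that] that False by (metis less_eq_real_def)
    show ?thesis
    proof (cases "card S \<le> CARD('w)")
      case True
      then show ?thesis using pos by (intro exI[of _ S] exI[of _ c]) auto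
    next
      case False
      then obtain d0 where d0: "\<exists>s\<in>S. d0 s \<noteq> 0" "\<forall>\<omega>. (\<Sum>s\<in>S. x s \<omega> * d0 s) = 0"
        using homogeneous_system_nontrivial_solution[of "UNIV :: 'w set" S "\<lambda>\<omega> s. x s \<omega>"]
          less.prems(1) by auto
      \<comment> \<open>A dependence may be negated, so its sign is chosen such that moving along it
        does not lower the objective.\<close>
      define d where "d = (if 0 \<le> (\<Sum>s\<in>S. d0 s * f s) then d0 else (\<lambda>s. - d0 s))"
      have d: "\<exists>s\<in>S. d s \<noteq> 0" "\<And>\<omega>. (\<Sum>s\<in>S. d s * x s \<omega>) = 0" "0 \<le> (\<Sum>s\<in>S. d s * f s)"
        using d0 by (auto simp: d_def sum_negf mult.commute)
      \<comment> \<open>Adding the dependence over all coordinates gives a relation with positive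
        coefficients, the masses of the vectors. Hence \<open>d\<close> has a negative entry,
        whichever sign was chosen.\<close>
      have "(\<Sum>s\<in>S. (\<Sum>\<omega>\<in>UNIV. x s \<omega>) * d s) = (\<Sum>\<omega>\<in>UNIV. \<Sum>s\<in>S. d s * x s \<omega>)"
        by (subst sum.swap) (simp add: sum_distrib_left mult.commute)
      then have "(\<Sum>s\<in>S. (\<Sum>\<omega>\<in>UNIV. x s \<omega>) * d s) = 0" by (simp add: d(2))
      then have "\<exists>s\<in>S. d s < 0"
        using weighted_sum_zero_imp_negative[of S "\<lambda>s. \<Sum>\<omega>\<in>UNIV. x s \<omega>" d] less.prems(1,3) d(1)
        by blast
      then obtain t v where t: "t > 0" "\<And>s. s \<in> S \<Longrightarrow> 0 \<le> c s + t * d s"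
          "v \<in> S" "c v + t * d v = 0"
        using step_to_boundary[of S c d] less.prems(1) pos by blast
      have expand: "(\<Sum>s\<in>S. (c s + t * d s) * g s) = (\<Sum>s\<in>S. c s * g s) + t * (\<Sum>s\<in>S. d s * g s)" for g
        by (simp add: algebra_simps sum.distrib sum_distrib_left)
      show ?thesis
        by (rule drop_zero[of v "\<lambda>s. c s + t * d s"]) (use t d in \<open>simp_all add: expand\<close>)
    qed
  qed
qed

section \<open>The value of a signal: homogeneity and affine directions\<close>

text \<open>This is \<open>F\<close> of the introduction for \<open>r = \<mu> / \<theta>\<close>.
  The first factor is then the probability of the signal under \<mu>, and the cost divided by the
  mass is the full price, by homogeneity of \<open>cost\<close>. The zero vector has value
  0.\<close>

definition signal_value ::
    "'a set \<Rightarrow> ('w::finite \<Rightarrow> 'a \<Rightarrow> real) \<Rightarrow> ('w \<Rightarrow> real) \<Rightarrow> ('w \<Rightarrow> real) \<Rightarrow> real" where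
  "signal_value A u r x = (\<Sum>\<omega>\<in>UNIV. r \<omega> * x \<omega>) * cost A u x / (\<Sum>\<omega>\<in>UNIV. x \<omega>)"

lemma cost_scale:
  assumes "finite A" and "A \<noteq> {}" and "0 \<le> c"
  shows "cost A u (\<lambda>\<omega>. c * x \<omega>) = c * cost A u x"
proof -
  have "c * (MAX a\<in>A. \<Sum>\<omega>\<in>UNIV. x \<omega> * u \<omega> a) = Max ((*) c ` (\<lambda>a. \<Sum>\<omega>\<in>UNIV. x \<omega> * u \<omega> a) ` A)"
    using assms by (intro mono_Max_commute) (auto intro: monoI mult_left_mono)
  then show ?thesis
    by (simp add: cost_def image_image right_diff_distrib sum_distrib_left mult.assoc)
qed

lemma cost_nonneg:
  assumes "finite A" and "A \<noteq> {}" and "\<And>\<omega>. 0 \<le> x \<omega>"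
  shows "0 \<le> cost A u x"
proof -
  have "(\<Sum>\<omega>\<in>UNIV. x \<omega> * u \<omega> a) \<le> (\<Sum>\<omega>\<in>UNIV. x \<omega> * (MAX a\<in>A. u \<omega> a))" if "a \<in> A" for a
    using assms that by (intro sum_mono mult_left_mono Max_ge) auto
  then show ?thesis using assms by (simp add: cost_def)
qed

text \<open>Along \<open>d\<close> the expected utilities of all actions shift by the same amount
  \<open>t * \<kappa>\<close>, so their maximum has no kink; the other term of the cost is linear
  anyway. The sign of \<open>t\<close> is arbitrary, as both directions are used later.\<close>

lemma cost_affine:
  assumes "finite A" and "A \<noteq> {}" and "\<And>a. a \<in> A \<Longrightarrow> (\<Sum>\<omega>\<in>UNIV. d \<omega> * u \<omega> a) = \<kappa>"
  shows "cost A u (\<lambda>\<omega>. x \<omega> + t * d \<omega>) =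
    cost A u x + t * ((\<Sum>\<omega>\<in>UNIV. d \<omega> * (MAX a\<in>A. u \<omega> a)) - \<kappa>)"
proof -
  have "(\<Sum>\<omega>\<in>UNIV. (x \<omega> + t * d \<omega>) * g \<omega>) =
      (\<Sum>\<omega>\<in>UNIV. x \<omega> * g \<omega>) + t * (\<Sum>\<omega>\<in>UNIV. d \<omega> * g \<omega>)" for g
    by (simp add: distrib_right sum.distrib sum_distrib_left mult.assoc)
  then have "(MAX a\<in>A. \<Sum>\<omega>\<in>UNIV. (x \<omega> + t * d \<omega>) * u \<omega> a) =
      (MAX a\<in>A. (\<Sum>\<omega>\<in>UNIV. x \<omega> * u \<omega> a) + t * \<kappa>)"
    and "(\<Sum>\<omega>\<in>UNIV. (x \<omega> + t * d \<omega>) * (MAX a\<in>A. u \<omega> a)) = (\<Sum>\<omega>\<in>UNIV. x \<omega> * (MAX a\<in>A. u \<omega> a))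
      + t * (\<Sum>\<omega>\<in>UNIV. d \<omega> * (MAX a\<in>A. u \<omega> a))"
    using assms(3) by (simp_all cong: image_cong)
  then show ?thesis
    using assms(1,2) by (simp add: cost_def Max_add_commute right_diff_distrib)
qed

lemma signal_value_scale:
  assumes "finite A" and "A \<noteq> {}" and "0 \<le> c"
  shows "signal_value A u r (\<lambda>\<omega>. c * x \<omega>) = c * signal_value A u r x"
proof -
  have "(\<Sum>\<omega>\<in>UNIV. r \<omega> * (c * x \<omega>)) = c * (\<Sum>\<omega>\<in>UNIV. r \<omega> * x \<omega>)"
    by (simp add: sum_distrib_left mult.left_commute)
  then show ?thesis
    using assms by (simp add: signal_value_def cost_scale flip: sum_distrib_left)
qed

text \<open>The direction fixes the first factor and the denominator, so the value varies only
  through the cost.\<close>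

lemma signal_value_affine:
  assumes "finite A" and "A \<noteq> {}" and "\<And>a. a \<in> A \<Longrightarrow> (\<Sum>\<omega>\<in>UNIV. d \<omega> * u \<omega> a) = \<kappa>"
    and "(\<Sum>\<omega>\<in>UNIV. d \<omega>) = 0" and "(\<Sum>\<omega>\<in>UNIV. r \<omega> * d \<omega>) = 0"
  shows "signal_value A u r (\<lambda>\<omega>. x \<omega> + t * d \<omega>) = signal_value A u r x +
    t * ((\<Sum>\<omega>\<in>UNIV. r \<omega> * x \<omega>) * ((\<Sum>\<omega>\<in>UNIV. d \<omega> * (MAX a\<in>A. u \<omega> a)) - \<kappa>) / (\<Sum>\<omega>\<in>UNIV. x \<omega>))"
proof -
  have "(\<Sum>\<omega>\<in>UNIV. r \<omega> * (x \<omega> + t * d \<omega>)) = (\<Sum>\<omega>\<in>UNIV. r \<omega> * x \<omega>) + t * (\<Sum>\<omega>\<in>UNIV. r \<omega> * d \<omega>)"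
    by (simp add: distrib_left sum.distrib sum_distrib_left mult.left_commute)
  moreover have "(\<Sum>\<omega>\<in>UNIV. x \<omega> + t * d \<omega>) = (\<Sum>\<omega>\<in>UNIV. x \<omega>)"
    using assms(4) by (simp add: sum.distrib flip: sum_distrib_left)
  ultimately show ?thesis
    using assms by (simp add: signal_value_def cost_affine[OF assms(1-3)] distrib_left add_divide_distrib)
qed

section \<open>Splitting a part into sparse parts\<close>

text \<open>A count of equations: one for the mass, one for \<open>r\<close>, and
  \<open>card A - 1\<close> for utility differences to a fixed action \<open>a0\<close>. These are
  at most \<open>card A + 1\<close>, fewer than the coordinates in the support of
  \<open>x\<close>.\<close>

lemma exists_linearity_direction:
  fixes x r :: "'w::finite \<Rightarrow> real"
  assumes "finite A" and "A \<noteq> {}" and "card A + 1 < norm0 x"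
  obtains d \<kappa> where "\<exists>\<omega>. d \<omega> \<noteq> 0" and "\<And>\<omega>. x \<omega> = 0 \<Longrightarrow> d \<omega> = 0" and "(\<Sum>\<omega>\<in>UNIV. d \<omega>) = 0"
    and "(\<Sum>\<omega>\<in>UNIV. r \<omega> * d \<omega>) = 0" and "\<And>a. a \<in> A \<Longrightarrow> (\<Sum>\<omega>\<in>UNIV. d \<omega> * u \<omega> a) = \<kappa>"
proof -
  obtain a0 where a0: "a0 \<in> A" using assms by blast
  \<comment> \<open>The equations are indexed by their own coefficient vectors; coinciding ones
    merge, which only lowers the count.\<close>
  define I where "I = {\<lambda>_. 1, r} \<union> (\<lambda>a \<omega>. u \<omega> a - u \<omega> a0) ` (A - {a0})"
  define W where "W = {\<omega>. x \<omega> \<noteq> 0}"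
  have "card I \<le> card {\<lambda>_. 1, r} + card ((\<lambda>a \<omega>. u \<omega> a - u \<omega> a0) ` (A - {a0}))"
    unfolding I_def by (rule card_Un_le)
  also have "\<dots> \<le> 2 + card (A - {a0})"
    using assms(1) by (intro add_mono card_image_le) (auto simp: card_insert_if)
  also have "\<dots> = card A + 1"
    using card_Suc_Diff1[OF assms(1) a0] by simp
  finally have "card I < card W"
    using assms(3) by (simp add: norm0_def W_def)
  moreover have "finite I" "finite W" using assms(1) by (simp_all add: I_def)
  ultimately obtain d0 where d0: "\<exists>w\<in>W. d0 w \<noteq> 0" "\<forall>i\<in>I. (\<Sum>w\<in>W. i w * d0 w) = 0"
    using homogeneous_system_nontrivial_solution[of I W "\<lambda>i. i"] by blast
  define d where "d w = (if w \<in> W then d0 w else 0)" for w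
  have "(\<Sum>w\<in>UNIV. i w * d w) = (\<Sum>w\<in>W. i w * d0 w)" for i
    by (rule sum.mono_neutral_cong_right) (auto simp: d_def)
  then have d: "(\<Sum>w\<in>UNIV. i w * d w) = 0" if "i \<in> I" for i
    using d0(2) that by simp
  have "(\<Sum>\<omega>\<in>UNIV. d \<omega> * u \<omega> a) = (\<Sum>\<omega>\<in>UNIV. d \<omega> * u \<omega> a0)" if "a \<in> A" for a
  proof (cases "a = a0")
    case False
    then have "(\<Sum>\<omega>\<in>UNIV. (u \<omega> a - u \<omega> a0) * d \<omega>) = 0"
      using that by (intro d) (auto simp: I_def)
    then show ?thesis by (simp add: algebra_simps sum_subtractf)
  qed simp
  moreover have "(\<Sum>\<omega>\<in>UNIV. d \<omega>) = 0" using d[of "\<lambda>_. 1"] by (simp add: I_def)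
  moreover have "(\<Sum>\<omega>\<in>UNIV. r \<omega> * d \<omega>) = 0" using d[of r] by (simp add: I_def)
  moreover have "\<exists>\<omega>. d \<omega> \<noteq> 0" using d0(1) by (auto simp: d_def)
  moreover have "d \<omega> = 0" if "x \<omega> = 0" for \<omega> using that by (simp add: d_def W_def)
  ultimately show ?thesis using that by blast
qed

text \<open>Having sum zero, \<open>d\<close> has a negative entry, which lies in the support of
  \<open>x\<close>. The step ends when a coordinate of the support vanishes, and no coordinate
  outside becomes nonzero.\<close>

lemma step_to_sparser:
  fixes x d :: "'w::finite \<Rightarrow> real"
  assumes "\<And>\<omega>. 0 \<le> x \<omega>" and "\<And>\<omega>. x \<omega> = 0 \<Longrightarrow> d \<omega> = 0" and "\<exists>\<omega>. d \<omega> \<noteq> 0"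
    and "(\<Sum>\<omega>\<in>UNIV. d \<omega>) = 0"
  shows "\<exists>t>0. (\<forall>\<omega>. 0 \<le> x \<omega> + t * d \<omega>) \<and> norm0 (\<lambda>\<omega>. x \<omega> + t * d \<omega>) < norm0 x"
proof -
  define W where "W = {\<omega>. x \<omega> \<noteq> 0}"
  have pos: "x \<omega> > 0" if "\<omega> \<in> W" for \<omega>
    using assms(1)[of \<omega>] that by (simp add: W_def)
  have "\<exists>\<omega>. d \<omega> < 0"
    using weighted_sum_zero_imp_negative[of UNIV "\<lambda>_. 1" d] assms(3,4) by simp
  then have "\<exists>\<omega>\<in>W. d \<omega> < 0"
    using assms(2) by (force simp: W_def)
  then obtain t v where t: "t > 0" "\<And>\<omega>. \<omega> \<in> W \<Longrightarrow> 0 \<le> x \<omega> + t * d \<omega>"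
      "v \<in> W" "x v + t * d v = 0"
    using step_to_boundary[of W x d] pos by (metis finite)
  have "{\<omega>. x \<omega> + t * d \<omega> \<noteq> 0} \<subset> W"
    using t(3,4) assms(2) by (force simp: W_def)
  then have "norm0 (\<lambda>\<omega>. x \<omega> + t * d \<omega>) < norm0 x"
    unfolding norm0_def W_def by (intro psubset_card_mono) auto
  moreover have "0 \<le> x \<omega> + t * d \<omega>" for \<omega>
    using t(2)[of \<omega>] assms(2)[of \<omega>] by (cases "\<omega> \<in> W") (auto simp: W_def)
  ultimately show ?thesis using t(1) by blast
qed

lemma norm0_scale: "norm0 (\<lambda>\<omega>. c * x \<omega>) \<le> norm0 x"
  unfolding norm0_def by (intro card_mono) auto

text \<open>Stepping along \<open>d\<close> and along \<open>- d\<close> gives two sparser end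
  points of a segment through \<open>x\<close>. On it the value is affine, so \<open>x\<close> and
  its value are the same convex combination of the end points and theirs; homogeneity turns the
  weights into scaled parts. A list of parts keeps repetitions.\<close>

lemma sparse_decomposition:
  fixes x r :: "'w::finite \<Rightarrow> real"
  assumes "finite A" and "A \<noteq> {}" and "\<And>\<omega>. 0 \<le> x \<omega>"
  shows "\<exists>ys. (\<forall>y\<in>set ys. (\<forall>\<omega>. 0 \<le> y \<omega>) \<and> norm0 y \<le> card A + 1) \<and>
    (\<forall>\<omega>. (\<Sum>y\<leftarrow>ys. y \<omega>) = x \<omega>) \<and> (\<Sum>y\<leftarrow>ys. signal_value A u r y) = signal_value A u r x"
  using assms(3)
proof (induction "norm0 x" arbitrary: x rule: less_induct)
  case less
  show ?case
  proof (cases "norm0 x \<le> card A + 1")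
    case True
    then show ?thesis using less.prems by (intro exI[of _ "[x]"]) auto
  next
    case False
    then have "card A + 1 < norm0 x" by simp
    then obtain d \<kappa> where d:
      "\<exists>\<omega>. d \<omega> \<noteq> 0" "\<And>\<omega>. x \<omega> = 0 \<Longrightarrow> d \<omega> = 0" "(\<Sum>\<omega>\<in>UNIV. d \<omega>) = 0"
      "(\<Sum>\<omega>\<in>UNIV. r \<omega> * d \<omega>) = 0" "\<And>a. a \<in> A \<Longrightarrow> (\<Sum>\<omega>\<in>UNIV. d \<omega> * u \<omega> a) = \<kappa>"
      using exists_linearity_direction[OF assms(1,2), of x r u] by blast
    obtain k where k: "\<And>t. signal_value A u r (\<lambda>\<omega>. x \<omega> + t * d \<omega>) = signal_value A u r x + t * k"
      using signal_value_affine[OF assms(1,2), of d u \<kappa> r x] d(3-5) by blast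
    obtain t where t: "t > 0" "\<And>\<omega>. 0 \<le> x \<omega> + t * d \<omega>" "norm0 (\<lambda>\<omega>. x \<omega> + t * d \<omega>) < norm0 x"
      using step_to_sparser[of x d] less.prems d by blast
    obtain t' where t': "t' > 0" "\<And>\<omega>. 0 \<le> x \<omega> - t' * d \<omega>" "norm0 (\<lambda>\<omega>. x \<omega> - t' * d \<omega>) < norm0 x"
      using step_to_sparser[of x "\<lambda>\<omega>. - d \<omega>"] less.prems d by (auto simp: sum_negf)
    define p where "p = t' / (t + t')"
    define q where "q = t / (t + t')"
    have pq: "0 \<le> p" "0 \<le> q" "p + q = 1" "p * t = q * t'"
      using t(1) t'(1) by (auto simp: p_def q_def add_divide_distrib[symmetric])
    \<comment> \<open>Applied twice at the end: with \<open>d \<omega>\<close> for the coordinates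
      and with the slope \<open>k\<close> for the values.\<close>
    have split: "p * (z + t * e) + q * (z - t' * e) = z" for z e
      using pq(3,4) by algebra
    obtain ys where ys: "\<And>y. y \<in> set ys \<Longrightarrow> (\<forall>\<omega>. 0 \<le> y \<omega>) \<and> norm0 y \<le> card A + 1"
      "\<And>\<omega>. (\<Sum>y\<leftarrow>ys. y \<omega>) = p * (x \<omega> + t * d \<omega>)"
      "(\<Sum>y\<leftarrow>ys. signal_value A u r y) = p * (signal_value A u r x + t * k)"
      using less.hyps[of "\<lambda>\<omega>. p * (x \<omega> + t * d \<omega>)"] t pq
        norm0_scale[of p "\<lambda>\<omega>. x \<omega> + t * d \<omega>"]
      by (auto simp: signal_value_scale[OF assms(1,2)] k)
    have k': "signal_value A u r (\<lambda>\<omega>. x \<omega> - t' * d \<omega>) = signal_value A u r x - t' * k"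
      using k[of "- t'"] by simp
    obtain zs where zs: "\<And>y. y \<in> set zs \<Longrightarrow> (\<forall>\<omega>. 0 \<le> y \<omega>) \<and> norm0 y \<le> card A + 1"
      "\<And>\<omega>. (\<Sum>y\<leftarrow>zs. y \<omega>) = q * (x \<omega> - t' * d \<omega>)"
      "(\<Sum>y\<leftarrow>zs. signal_value A u r y) = q * (signal_value A u r x - t' * k)"
      using less.hyps[of "\<lambda>\<omega>. q * (x \<omega> - t' * d \<omega>)"] t' pq
        norm0_scale[of q "\<lambda>\<omega>. x \<omega> - t' * d \<omega>"]
      by (auto simp: signal_value_scale[OF assms(1,2)] k')
    show ?thesis
      using ys zs by (intro exI[of _ "ys @ zs"]) (auto simp: split)
  qed
qed

lemma sparse_decomposition_family:
  fixes x :: "'s \<Rightarrow> 'w::finite \<Rightarrow> real"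
  assumes "finite A" and "A \<noteq> {}" and "finite T" and "\<And>s \<omega>. s \<in> T \<Longrightarrow> 0 \<le> x s \<omega>"
  shows "\<exists>ys. (\<forall>y\<in>set ys. (\<forall>\<omega>. 0 \<le> y \<omega>) \<and> norm0 y \<le> card A + 1) \<and>
    (\<forall>\<omega>. (\<Sum>y\<leftarrow>ys. y \<omega>) = (\<Sum>s\<in>T. x s \<omega>)) \<and>
    (\<Sum>y\<leftarrow>ys. signal_value A u r y) = (\<Sum>s\<in>T. signal_value A u r (x s))"
  using assms(3,4)
proof (induction T rule: finite_induct)
  case empty
  then show ?case by (intro exI[of _ "[]"]) auto
next
  case (insert s T)
  obtain ys where "\<forall>y\<in>set ys. (\<forall>\<omega>. 0 \<le> y \<omega>) \<and> norm0 y \<le> card A + 1"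
    "\<forall>\<omega>. (\<Sum>y\<leftarrow>ys. y \<omega>) = (\<Sum>s\<in>T. x s \<omega>)"
    "(\<Sum>y\<leftarrow>ys. signal_value A u r y) = (\<Sum>s\<in>T. signal_value A u r (x s))"
    using insert.IH insert.prems by auto
  moreover obtain zs where "\<forall>y\<in>set zs. (\<forall>\<omega>. 0 \<le> y \<omega>) \<and> norm0 y \<le> card A + 1"
    "\<forall>\<omega>. (\<Sum>y\<leftarrow>zs. y \<omega>) = x s \<omega>"
    "(\<Sum>y\<leftarrow>zs. signal_value A u r y) = signal_value A u r (x s)"
    using sparse_decomposition[OF assms(1,2), of "x s" u r] insert.prems by auto
  ultimately show ?case
    using insert.hyps by (intro exI[of _ "zs @ ys"]) auto
qed

section \<open>Existence of an optimal splitting by compactness\<close>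

lemma continuous_on_Max_image:
  fixes f :: "'a \<Rightarrow> 'x::topological_space \<Rightarrow> real"
  assumes "finite A" and "A \<noteq> {}" and "\<And>a. a \<in> A \<Longrightarrow> continuous_on K (f a)"
  shows "continuous_on K (\<lambda>z. MAX a\<in>A. f a z)"
  using assms
proof (induction A rule: finite_ne_induct)
  case (insert a A)
  then show ?case by (auto intro!: continuous_on_max)
qed simp

lemma continuous_on_cost:
  fixes g :: "'x::topological_space \<Rightarrow> 'w::finite \<Rightarrow> real"
  assumes "finite A" and "A \<noteq> {}" and "\<And>\<omega>. continuous_on K (\<lambda>z. g z \<omega>)"
  shows "continuous_on K (\<lambda>z. cost A u (g z))"
  unfolding cost_def
  by (intro continuous_intros continuous_on_Max_image assms)

text \<open>Parts are indexed by states merely to have \<open>CARD('w)\<close> labels; fixing their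
  number puts the problem into finite dimension, where a continuous function attains its maximum on
  a compact set.\<close>

lemma exists_optimal_splitting:
  fixes \<theta> r :: "'w::finite \<Rightarrow> real"
  assumes A: "finite A" "A \<noteq> {}" and \<theta>: "distribution_on UNIV \<theta>"
  shows "\<exists>x :: 'w \<Rightarrow> 'w \<Rightarrow> real. (\<forall>s \<omega>. 0 \<le> x s \<omega>) \<and> (\<forall>\<omega>. (\<Sum>s\<in>UNIV. x s \<omega>) = \<theta> \<omega>) \<and>
    (\<forall>y :: 'w \<Rightarrow> 'w \<Rightarrow> real. (\<forall>s \<omega>. 0 \<le> y s \<omega>) \<longrightarrow> (\<forall>\<omega>. (\<Sum>s\<in>UNIV. y s \<omega>) = \<theta> \<omega>) \<longrightarrow>
      (\<Sum>s\<in>UNIV. signal_value A u r (y s)) \<le> (\<Sum>s\<in>UNIV. signal_value A u r (x s)))"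
proof -
  have \<theta>_nonneg: "0 \<le> \<theta> \<omega>" and \<theta>_sum: "(\<Sum>\<omega>\<in>UNIV. \<theta> \<omega>) = 1" for \<omega>
    using \<theta> by (auto simp: distribution_on_def)
  \<comment> \<open>Optimizing over weights and normalized parts keeps the objective continuous, as no division remains.\<close>
  define K :: "((real^'w) \<times> (real^('w \<times> 'w))) set" where
    "K = (cbox 0 1 \<times> cbox 0 1) \<inter> {z. (\<forall>s. (\<Sum>\<omega>\<in>UNIV. snd z $ (s, \<omega>)) = 1) \<and>
      (\<forall>\<omega>. (\<Sum>s\<in>UNIV. fst z $ s * snd z $ (s, \<omega>)) = \<theta> \<omega>)}"
  define row where "row z s \<omega> = snd z $ (s, \<omega>)" for z :: "(real^'w) \<times> (real^('w \<times> 'w))" and s \<omega>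
  define V where "V z = (\<Sum>s\<in>UNIV. fst z $ s * ((\<Sum>\<omega>\<in>UNIV. r \<omega> * row z s \<omega>) * cost A u (row z s)))"
    for z
  have K_iff: "(w, E) \<in> K \<longleftrightarrow> (\<forall>s. 0 \<le> w $ s \<and> w $ s \<le> 1) \<and> (\<forall>s \<omega>. 0 \<le> E $ (s, \<omega>) \<and> E $ (s, \<omega>) \<le> 1) \<and>
      (\<forall>s. (\<Sum>\<omega>\<in>UNIV. E $ (s, \<omega>)) = 1) \<and> (\<forall>\<omega>. (\<Sum>s\<in>UNIV. w $ s * E $ (s, \<omega>)) = \<theta> \<omega>)" for w E
    by (auto simp: K_def mem_box_cart)
  \<comment> \<open>The upper bounds in the boxes are automatic: summing \<open>ae\<close> over the
    states shows that the weights add up to 1.\<close>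
  have K_I: "(\<chi> s. a s, \<chi> p. e (fst p) (snd p)) \<in> K"
    if nn: "\<And>s. 0 \<le> a s" "\<And>s \<omega>. 0 \<le> e s \<omega>" and e1: "\<And>s. (\<Sum>\<omega>\<in>UNIV. e s \<omega>) = 1"
      and ae: "\<And>\<omega>. (\<Sum>s\<in>UNIV. a s * e s \<omega>) = \<theta> \<omega>" for a :: "'w \<Rightarrow> real" and e
  proof -
    have "(\<Sum>s\<in>UNIV. a s) = (\<Sum>s\<in>UNIV. \<Sum>\<omega>\<in>UNIV. a s * e s \<omega>)"
      by (simp add: e1 flip: sum_distrib_left)
    also have "\<dots> = 1"
      by (subst sum.swap) (simp add: ae \<theta>_sum)
    finally have "a s \<le> 1" for s
      using member_le_sum[of s UNIV a] nn by simp
    moreover have "e s \<omega> \<le> 1" for s \<omega>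
      using member_le_sum[of \<omega> UNIV "e s"] nn e1[of s] by simp
    ultimately show ?thesis using that by (simp add: K_iff)
  qed
  have "closed {z :: (real^'w) \<times> (real^('w \<times> 'w)). (\<forall>s. (\<Sum>\<omega>\<in>UNIV. snd z $ (s, \<omega>)) = 1) \<and>
      (\<forall>\<omega>. (\<Sum>s\<in>UNIV. fst z $ s * snd z $ (s, \<omega>)) = \<theta> \<omega>)}"
    by (intro closed_Collect_conj closed_Collect_all closed_Collect_eq continuous_intros)
  then have "compact K"
    unfolding K_def by (intro compact_Int_closed compact_Times compact_cbox)
  \<comment> \<open>The witness is full revelation: weight \<open>\<theta> s\<close> on the point
    mass at \<open>s\<close>.\<close>
  moreover have "K \<noteq> {}"
    using K_I[of \<theta> "\<lambda>s \<omega>. of_bool (s = \<omega>)"] \<theta>_nonneg by (auto simp: of_bool_def if_distrib cong: if_cong)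
  moreover have "continuous_on K V"
    unfolding V_def row_def by (intro continuous_intros continuous_on_cost A)
  ultimately obtain z where z: "z \<in> K" "\<And>z'. z' \<in> K \<Longrightarrow> V z' \<le> V z"
    using continuous_attains_sup[of K V] by blast
  obtain w E where "z = (w, E)" by (cases z)
  with z have wE: "(w, E) \<in> K" and max: "\<And>z. z \<in> K \<Longrightarrow> V z \<le> V (w, E)"
    by simp_all
  \<comment> \<open>The division in \<open>signal_value\<close> is by the mass of
    \<open>e s\<close>, which is 1, and the weight moves inside by homogeneity.\<close>
  have V_eq: "V (\<chi> s. a s, \<chi> p. e (fst p) (snd p)) = (\<Sum>s\<in>UNIV. signal_value A u r (\<lambda>\<omega>. a s * e s \<omega>))"
    if "\<And>s. 0 \<le> a s" "\<And>s. (\<Sum>\<omega>\<in>UNIV. e s \<omega>) = 1" for a e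
    using that by (simp add: V_def row_def[abs_def] signal_value_scale[OF A] signal_value_def[of A u r "e _"])
  define x where "x s \<omega> = w $ s * E $ (s, \<omega>)" for s \<omega>
  have "V (w, E) = (\<Sum>s\<in>UNIV. signal_value A u r (x s))"
    using V_eq[of "($) w" "\<lambda>s \<omega>. E $ (s, \<omega>)"] wE by (simp add: K_iff x_def[abs_def])
  moreover have "(\<Sum>s\<in>UNIV. signal_value A u r (y s)) \<le> V (w, E)"
    if y: "\<And>s \<omega>. 0 \<le> y s \<omega>" "\<And>\<omega>. (\<Sum>s\<in>UNIV. y s \<omega>) = \<theta> \<omega>" for y :: "'w \<Rightarrow> 'w \<Rightarrow> real"
  proof -
    define a where "a s = (\<Sum>\<omega>\<in>UNIV. y s \<omega>)" for s
    \<comment> \<open>A part of mass zero gets weight zero, so any distribution can stand in for its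
      normalization; \<theta> is one at hand.\<close>
    define e where "e s \<omega> = (if a s = 0 then \<theta> \<omega> else y s \<omega> / a s)" for s \<omega>
    have "0 \<le> a s" for s by (simp add: a_def sum_nonneg y)
    moreover have "0 \<le> e s \<omega>" for s \<omega>
      using \<open>0 \<le> a s\<close> by (simp add: e_def \<theta>_nonneg y)
    moreover have "(\<Sum>\<omega>\<in>UNIV. e s \<omega>) = 1" for s
      by (cases "a s = 0") (simp_all add: e_def \<theta>_sum a_def flip: sum_divide_distrib)
    moreover have ae: "a s * e s \<omega> = y s \<omega>" for s \<omega>
      using y by (cases "a s = 0") (auto simp: e_def a_def sum_nonneg_eq_0_iff)
    ultimately show ?thesis
      using max[OF K_I[of a e]] V_eq[of a e] y by simp
  qed
  moreover have "0 \<le> x s \<omega>" and "(\<Sum>s\<in>UNIV. x s \<omega>) = \<theta> \<omega>" for s \<omega>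
    using wE by (simp_all add: K_iff x_def)
  ultimately show ?thesis by (intro exI[of _ x]) auto
qed

section \<open>Revenue in terms of parts, and reduction of their number\<close>

text \<open>A price above the cost earns nothing, one below it earns less than the cost, and the
  cost is nonnegative; so the full price is best for each signal separately.\<close>

lemma revenue_le_signal_values:
  fixes \<theta> :: "'w::finite \<Rightarrow> real"
  assumes A: "finite A" "A \<noteq> {}" and "\<And>\<omega>. 0 \<le> \<mu> \<omega>" and "\<And>\<omega>. 0 < \<theta> \<omega>"
    and "signaling_scheme S \<pi>"
  shows "revenue A u \<mu> \<theta> S \<pi> p \<le>
    (\<Sum>s\<in>S. signal_value A u (\<lambda>\<omega>. \<mu> \<omega> / \<theta> \<omega>) (\<lambda>\<omega>. \<theta> \<omega> * \<pi> \<omega> s))"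
    and "revenue A u \<mu> \<theta> S \<pi> (full_price A u \<theta> \<pi>) =
    (\<Sum>s\<in>S. signal_value A u (\<lambda>\<omega>. \<mu> \<omega> / \<theta> \<omega>) (\<lambda>\<omega>. \<theta> \<omega> * \<pi> \<omega> s))"
proof -
  have \<pi>: "0 \<le> \<pi> \<omega> s" if "s \<in> S" for \<omega> s
    using assms(5) that by (auto simp: signaling_scheme_def distribution_on_def)
  have prob: "0 \<le> signal_prob \<theta> \<pi> s" if "s \<in> S" for s
    unfolding signal_prob_def using \<pi> that assms(4) by (intro sum_nonneg mult_nonneg_nonneg) (auto intro: less_imp_le)
  \<comment> \<open>This includes signals of probability zero, where both sides are 0 because
    \<open>inverse 0 = 0\<close>.\<close>
  have cost_eq: "cost A u (posterior \<theta> \<pi> s) = cost A u (\<lambda>\<omega>. \<theta> \<omega> * \<pi> \<omega> s) / signal_prob \<theta> \<pi> s"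
    if "s \<in> S" for s
    using cost_scale[OF A, of "inverse (signal_prob \<theta> \<pi> s)" u "\<lambda>\<omega>. \<theta> \<omega> * \<pi> \<omega> s"] prob[OF that]
    by (simp add: posterior_def[abs_def] divide_inverse mult.commute)
  have value_eq: "(\<Sum>s\<in>S. signal_value A u (\<lambda>\<omega>. \<mu> \<omega> / \<theta> \<omega>) (\<lambda>\<omega>. \<theta> \<omega> * \<pi> \<omega> s)) =
      (\<Sum>\<omega>\<in>UNIV. \<mu> \<omega> * (\<Sum>s\<in>S. \<pi> \<omega> s * cost A u (posterior \<theta> \<pi> s)))"
  proof -
    have "\<theta> \<omega> \<noteq> 0" for \<omega> using assms(4)[of \<omega>] by simp
    then have "signal_value A u (\<lambda>\<omega>. \<mu> \<omega> / \<theta> \<omega>) (\<lambda>\<omega>. \<theta> \<omega> * \<pi> \<omega> s) =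
        (\<Sum>\<omega>\<in>UNIV. \<mu> \<omega> * (\<pi> \<omega> s * cost A u (posterior \<theta> \<pi> s)))" if "s \<in> S" for s
      using cost_eq[OF that]
      by (simp add: signal_value_def signal_prob_def sum_distrib_right sum_divide_distrib mult.assoc)
    then show ?thesis
      unfolding sum_distrib_left by (subst sum.swap) (rule sum.cong[OF refl], simp)
  qed
  have "posterior \<theta> \<pi> s \<omega> \<ge> 0" if "s \<in> S" for s \<omega>
    using \<pi>[OF that] prob[OF that] assms(4)[of \<omega>] by (simp add: posterior_def)
  then have "0 \<le> cost A u (posterior \<theta> \<pi> s)" if "s \<in> S" for s
    using that A by (intro cost_nonneg) auto
  then have "p s * of_bool (p s \<le> cost A u (posterior \<theta> \<pi> s)) \<le> cost A u (posterior \<theta> \<pi> s)"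
    if "s \<in> S" for s
    using that by simp
  then show "revenue A u \<mu> \<theta> S \<pi> p \<le>
    (\<Sum>s\<in>S. signal_value A u (\<lambda>\<omega>. \<mu> \<omega> / \<theta> \<omega>) (\<lambda>\<omega>. \<theta> \<omega> * \<pi> \<omega> s))"
    unfolding value_eq revenue_def mult.assoc using assms(3) \<pi>
    by (intro sum_mono mult_left_mono) auto
  show "revenue A u \<mu> \<theta> S \<pi> (full_price A u \<theta> \<pi>) =
    (\<Sum>s\<in>S. signal_value A u (\<lambda>\<omega>. \<mu> \<omega> / \<theta> \<omega>) (\<lambda>\<omega>. \<theta> \<omega> * \<pi> \<omega> s))"
    unfolding value_eq revenue_def by (simp add: full_price_def)
qed

text \<open>\<open>conic_caratheodory_objective\<close> with all weights 1, after discarding the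
  zero parts, which have value 0 and would violate its positivity condition.\<close>

lemma exists_reduced_splitting:
  fixes x :: "'s \<Rightarrow> 'w::finite \<Rightarrow> real"
  assumes A: "finite A" "A \<noteq> {}" and "finite S" and nonneg: "\<And>s \<omega>. s \<in> S \<Longrightarrow> 0 \<le> x s \<omega>"
  shows "\<exists>T c. T \<subseteq> S \<and> card T \<le> CARD('w) \<and> (\<forall>s\<in>T. 0 < c s) \<and>
    (\<forall>s\<in>T. 0 < (\<Sum>\<omega>\<in>UNIV. x s \<omega>)) \<and>
    (\<forall>\<omega>. (\<Sum>s\<in>T. c s * x s \<omega>) = (\<Sum>s\<in>S. x s \<omega>)) \<and>
    (\<Sum>s\<in>S. signal_value A u r (x s)) \<le> (\<Sum>s\<in>T. signal_value A u r (\<lambda>\<omega>. c s * x s \<omega>))"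
proof -
  define S' where "S' = {s\<in>S. 0 < (\<Sum>\<omega>\<in>UNIV. x s \<omega>)}"
  have zero: "x s = (\<lambda>_. 0)" if "s \<in> S - S'" for s
  proof -
    have "(\<Sum>\<omega>\<in>UNIV. x s \<omega>) = 0"
      using that sum_nonneg[of UNIV "x s"] nonneg[of s] by (fastforce simp: S'_def)
    then show ?thesis
      using that nonneg[of s] by (auto simp: sum_nonneg_eq_0_iff fun_eq_iff)
  qed
  have S': "S' \<subseteq> S" "finite S'" "\<And>s \<omega>. s \<in> S' \<Longrightarrow> 0 \<le> x s \<omega>" "\<And>s. s \<in> S' \<Longrightarrow> 0 < (\<Sum>\<omega>\<in>UNIV. x s \<omega>)"
    using assms(3) nonneg by (auto simp: S'_def)
  obtain T c where T: "T \<subseteq> S'" "card T \<le> CARD('w)" "\<forall>s\<in>T. c s > 0"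
      "\<forall>\<omega>. (\<Sum>s\<in>T. c s * x s \<omega>) = (\<Sum>s\<in>S'. x s \<omega>)"
      "(\<Sum>s\<in>S'. signal_value A u r (x s)) \<le> (\<Sum>s\<in>T. c s * signal_value A u r (x s))"
    using conic_caratheodory_objective[of S' x "\<lambda>_. 1" "\<lambda>s. signal_value A u r (x s)"]
      S'(2-4) by simp blast
  have eq: "(\<Sum>s\<in>S'. x s \<omega>) = (\<Sum>s\<in>S. x s \<omega>)" for \<omega>
    using assms(3) S'(1) zero by (intro sum.mono_neutral_left) auto
  have "(\<Sum>s\<in>S. signal_value A u r (x s)) = (\<Sum>s\<in>S'. signal_value A u r (x s))"
    using assms(3) S'(1) zero by (intro sum.mono_neutral_right) (auto simp: signal_value_def)
  moreover have "(\<Sum>s\<in>T. c s * signal_value A u r (x s)) =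
      (\<Sum>s\<in>T. signal_value A u r (\<lambda>\<omega>. c s * x s \<omega>))"
    using T(3) by (intro sum.cong) (auto simp: signal_value_scale[OF A] less_imp_le)
  ultimately show ?thesis
    using T S'(1,4) by (intro exI[of _ T] exI[of _ c]) (auto simp: eq)
qed

text \<open>Brings a competitor with any finite number of signals into the class over which
  \<open>exists_optimal_splitting\<close> maximizes.\<close>

lemma exists_splitting_on_states:
  fixes y :: "'s \<Rightarrow> 'w::finite \<Rightarrow> real"
  assumes A: "finite A" "A \<noteq> {}" and "finite S" and "\<And>s \<omega>. s \<in> S \<Longrightarrow> 0 \<le> y s \<omega>"
  shows "\<exists>z :: 'w \<Rightarrow> 'w \<Rightarrow> real. (\<forall>s \<omega>. 0 \<le> z s \<omega>) \<and>
    (\<forall>\<omega>. (\<Sum>s\<in>UNIV. z s \<omega>) = (\<Sum>s\<in>S. y s \<omega>)) \<and>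
    (\<Sum>s\<in>S. signal_value A u r (y s)) \<le> (\<Sum>s\<in>UNIV. signal_value A u r (z s))"
proof -
  obtain T c where T: "T \<subseteq> S" "card T \<le> CARD('w)" "\<And>s. s \<in> T \<Longrightarrow> 0 < c s"
      "\<And>\<omega>. (\<Sum>s\<in>T. c s * y s \<omega>) = (\<Sum>s\<in>S. y s \<omega>)"
      "(\<Sum>s\<in>S. signal_value A u r (y s)) \<le> (\<Sum>s\<in>T. signal_value A u r (\<lambda>\<omega>. c s * y s \<omega>))"
    using exists_reduced_splitting[OF A assms(3), of y u r] assms(4) by blast
  obtain f :: "'s \<Rightarrow> 'w" where f: "inj_on f T"
    using card_le_inj[of T "UNIV :: 'w set"] T(1,2) assms(3) finite_subset by auto
  define z where "z w = (if w \<in> f ` T then (\<lambda>\<omega>. c (inv_into T f w) * y (inv_into T f w) \<omega>) else (\<lambda>_. 0))" for w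
  have z: "(\<Sum>w\<in>UNIV. h (z w)) = (\<Sum>s\<in>T. h (\<lambda>\<omega>. c s * y s \<omega>))" if "h (\<lambda>_. 0) = 0" for h :: "_ \<Rightarrow> real"
  proof -
    have "(\<Sum>w\<in>UNIV. h (z w)) = (\<Sum>w\<in>f ` T. h (z w))"
      using that by (intro sum.mono_neutral_right) (auto simp: z_def)
    then show ?thesis
      using f by (simp add: sum.reindex z_def)
  qed
  have "0 \<le> c s * y s \<omega>" if "s \<in> T" for s \<omega>
    using T(1,3) assms(4) that by (simp add: less_imp_le subset_iff)
  then have "0 \<le> z w \<omega>" for w \<omega>
    by (simp add: z_def inv_into_into)
  moreover have "(\<Sum>w\<in>UNIV. z w \<omega>) = (\<Sum>s\<in>S. y s \<omega>)" for \<omega>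
    using z[of "\<lambda>x. x \<omega>"] T(4) by simp
  moreover have "(\<Sum>w\<in>UNIV. signal_value A u r (z w)) = (\<Sum>s\<in>T. signal_value A u r (\<lambda>\<omega>. c s * y s \<omega>))"
    by (rule z) (simp add: signal_value_def)
  ultimately show ?thesis using T(5) by (intro exI[of _ z]) simp
qed

section \<open>Construction of the sparse optimal rule\<close>

theorem theorem3p4:
  fixes \<mu> \<theta> :: "'w::finite \<Rightarrow> real"
    and A :: "'a set"
    and u :: "'w \<Rightarrow> 'a \<Rightarrow> real"
  assumes "distribution_on UNIV \<mu>"
    and "distribution_on UNIV \<theta>"
    and "\<And>\<omega>. \<theta> \<omega> > 0"
    and "finite A" and "A \<noteq> {}"
    and "\<And>\<omega> a. a \<in> A \<Longrightarrow> 0 \<le> u \<omega> a \<and> u \<omega> a \<le> 1"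
  shows "\<exists>(S :: nat set) \<pi>. optimal_rule A u \<mu> \<theta> S \<pi> (full_price A u \<theta> \<pi>) \<and>
           card S \<le> CARD('w) \<and>
           (\<forall>s\<in>S. signal_prob \<theta> \<pi> s > 0 \<and> norm0 (posterior \<theta> \<pi> s) \<le> 2 * card A)"
proof -
  note A = \<open>finite A\<close> \<open>A \<noteq> {}\<close>
  define r where "r = (\<lambda>\<omega>. \<mu> \<omega> / \<theta> \<omega>)"
  have \<mu>: "0 \<le> \<mu> \<omega>" for \<omega> using assms(1) by (simp add: distribution_on_def)
  have \<theta>_nz: "\<theta> \<omega> \<noteq> 0" for \<omega> using assms(3)[of \<omega>] by simp
  note revenue = revenue_le_signal_values[of A \<mu> \<theta>, OF A \<mu> assms(3), folded r_def]
  obtain x :: "'w \<Rightarrow> 'w \<Rightarrow> real" where x: "\<And>s \<omega>. 0 \<le> x s \<omega>" "\<And>\<omega>. (\<Sum>s\<in>UNIV. x s \<omega>) = \<theta> \<omega>"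
    and x_max: "\<And>y :: 'w \<Rightarrow> 'w \<Rightarrow> real. (\<forall>s \<omega>. 0 \<le> y s \<omega>) \<Longrightarrow> (\<forall>\<omega>. (\<Sum>s\<in>UNIV. y s \<omega>) = \<theta> \<omega>) \<Longrightarrow>
      (\<Sum>s\<in>UNIV. signal_value A u r (y s)) \<le> (\<Sum>s\<in>UNIV. signal_value A u r (x s))"
    using exists_optimal_splitting[OF A assms(2), of u r] by blast
  \<comment> \<open>The optimal parts are made sparse at equal total value, though possibly too many
    arise.\<close>
  obtain ys where ys: "\<And>y. y \<in> set ys \<Longrightarrow> (\<forall>\<omega>. 0 \<le> y \<omega>) \<and> norm0 y \<le> card A + 1"
    and ys_sum: "\<And>\<omega>. (\<Sum>y\<leftarrow>ys. y \<omega>) = (\<Sum>s\<in>UNIV. x s \<omega>)"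
    and ys_value: "(\<Sum>y\<leftarrow>ys. signal_value A u r y) = (\<Sum>s\<in>UNIV. signal_value A u r (x s))"
    using sparse_decomposition_family[OF A finite[of UNIV], of x u r] x(1) by blast
  \<comment> \<open>Positions in \<open>ys\<close> serve as signals, so that equal parts stay
    distinct.\<close>
  define N where "N = {..<length ys}"
  have N_finite: "finite N" by (simp add: N_def)
  have nth: "0 \<le> (ys ! s) \<omega>" "norm0 (ys ! s) \<le> card A + 1" if "s \<in> N" for s \<omega>
    using ys[of "ys ! s"] that by (auto simp: N_def)
  have list_sum: "(\<Sum>y\<leftarrow>ys. h y) = (\<Sum>s\<in>N. h (ys ! s))" for h :: "_ \<Rightarrow> real"
    by (simp add: sum_list_sum_nth N_def lessThan_atLeast0)
  \<comment> \<open>The number of parts returns to at most \<open>CARD('w)\<close>. Each remaining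
    part is a multiple of an entry of \<open>ys\<close>, hence still sparse.\<close>
  obtain S c where S: "S \<subseteq> N" "card S \<le> CARD('w)" "\<And>s. s \<in> S \<Longrightarrow> 0 < c s"
      "\<And>s. s \<in> S \<Longrightarrow> 0 < (\<Sum>\<omega>\<in>UNIV. (ys ! s) \<omega>)"
      "\<And>\<omega>. (\<Sum>s\<in>S. c s * (ys ! s) \<omega>) = (\<Sum>s\<in>N. (ys ! s) \<omega>)"
      "(\<Sum>s\<in>N. signal_value A u r (ys ! s)) \<le> (\<Sum>s\<in>S. signal_value A u r (\<lambda>\<omega>. c s * (ys ! s) \<omega>))"
    using exists_reduced_splitting[OF A, of N "(!) ys" u r] nth(1) N_finite by blast
  define \<pi> where "\<pi> \<omega> s = c s * (ys ! s) \<omega> / \<theta> \<omega>" for \<omega> s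
  have weight: "\<theta> \<omega> * \<pi> \<omega> s = c s * (ys ! s) \<omega>" for \<omega> s
    using \<theta>_nz by (simp add: \<pi>_def)
  have "(\<Sum>s\<in>S. c s * (ys ! s) \<omega>) = \<theta> \<omega>" for \<omega>
    using S(5) ys_sum[of \<omega>] x(2) list_sum[of "\<lambda>y. y \<omega>"] by simp
  then have "(\<Sum>s\<in>S. \<pi> \<omega> s) = 1" for \<omega>
    using \<theta>_nz by (simp add: \<pi>_def flip: sum_divide_distrib)
  moreover have "0 \<le> \<pi> \<omega> s" if "s \<in> S" for \<omega> s
    using S(1,3) nth(1) assms(3)[of \<omega>] that by (simp add: \<pi>_def subset_iff less_imp_le)
  moreover have "finite S"
    using S(1) N_finite by (rule finite_subset)
  ultimately have scheme: "signaling_scheme S \<pi>"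
    by (simp add: signaling_scheme_def distribution_on_def)
  have "revenue A u \<mu> \<theta> S' \<pi>' p' \<le> revenue A u \<mu> \<theta> S \<pi> (full_price A u \<theta> \<pi>)"
    if sch: "signaling_scheme S' \<pi>'" for S' :: "nat set" and \<pi>' p'
  proof -
    define y where "y s \<omega> = \<theta> \<omega> * \<pi>' \<omega> s" for s \<omega>
    have y: "finite S'" "\<And>s \<omega>. s \<in> S' \<Longrightarrow> 0 \<le> y s \<omega>"
      using sch assms(3) by (auto simp: y_def signaling_scheme_def distribution_on_def less_imp_le)
    have y_sum: "(\<Sum>s\<in>S'. y s \<omega>) = \<theta> \<omega>" for \<omega>
      using sch by (simp add: y_def signaling_scheme_def distribution_on_def flip: sum_distrib_left)
    have "revenue A u \<mu> \<theta> S' \<pi>' p' \<le> (\<Sum>s\<in>S'. signal_value A u r (y s))"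
      unfolding y_def by (rule revenue(1)[OF sch])
    also have "\<dots> \<le> (\<Sum>s\<in>UNIV. signal_value A u r (x s))"
    proof -
      obtain z :: "'w \<Rightarrow> 'w \<Rightarrow> real" where "\<forall>s \<omega>. 0 \<le> z s \<omega>"
        "\<forall>\<omega>. (\<Sum>s\<in>UNIV. z s \<omega>) = (\<Sum>s\<in>S'. y s \<omega>)"
        "(\<Sum>s\<in>S'. signal_value A u r (y s)) \<le> (\<Sum>s\<in>UNIV. signal_value A u r (z s))"
        using exists_splitting_on_states[OF A y(1), of y u r] y(2) by blast
      then show ?thesis using x_max[of z] y_sum by simp
    qed
    also have "\<dots> \<le> (\<Sum>s\<in>S. signal_value A u r (\<lambda>\<omega>. c s * (ys ! s) \<omega>))"
      using S(6) ys_value list_sum[of "signal_value A u r"] by simp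
    also have "\<dots> = revenue A u \<mu> \<theta> S \<pi> (full_price A u \<theta> \<pi>)"
      using revenue(2)[OF scheme, of u] by (simp add: weight)
    finally show ?thesis .
  qed
  then have "optimal_rule A u \<mu> \<theta> S \<pi> (full_price A u \<theta> \<pi>)"
    using scheme by (simp add: optimal_rule_def)
  moreover have "signal_prob \<theta> \<pi> s > 0" if "s \<in> S" for s
    using S(3,4) that by (simp add: signal_prob_def weight flip: sum_distrib_left)
  moreover have "norm0 (posterior \<theta> \<pi> s) \<le> 2 * card A" if "s \<in> S" for s
  proof -
    have "posterior \<theta> \<pi> s = (\<lambda>\<omega>. c s / signal_prob \<theta> \<pi> s * (ys ! s) \<omega>)"
      by (simp add: posterior_def weight fun_eq_iff)
    then have "norm0 (posterior \<theta> \<pi> s) \<le> norm0 (ys ! s)"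
      using norm0_scale[of "c s / signal_prob \<theta> \<pi> s" "ys ! s"] by simp
    also have "\<dots> \<le> card A + 1" using nth(2) S(1) that by blast
    \<comment> \<open>Here \<open>card A \<ge> 1\<close> is what matters.\<close>
    also have "\<dots> \<le> 2 * card A" using A card_gt_0_iff[of A] by simp
    finally show ?thesis .
  qed
  ultimately show ?thesis using S(2) by blast
qed

end
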